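(* Let $K$ be a field and let $A$ be a finite subset of the multiplicative group $K^{*}=K\setminus\{0\}$. Let $A\dot\times A=\{xy : x,y\in A,\ x\neq y\}$. Assume that some element $c\in A\dot\times A$ has exactly two (symmetric to each other) representations $c=ab=ba$ with $a,b\in A$, $a\neq b$ (that is, the only ordered pairs $(x,y)\in A\times A$ with $x\neq y$ and $xy=c$ are $(a,b)$ and $(b,a)$). Then $|A\dot\times A|\geq 2|A|-4$.
   Context: For a finite subset $A$ of a multiplicatively written abelian group, the restricted product set is $A\dot\times A=\{xy : x,y\in A,\ x\neq y\}$. Only representations $c=xy$ with $x\neq y$ are counted; $c$ may additionally be of the form $d^2$ with $d\in A$. *)

theory Defs
  imports Main
begin

definition restricted_product :: "'a::times set \<Rightarrow> 'a set" where
  "restricted_product A = {x * y | x y. x \<in> A \<and> y \<in> A \<and> x \<noteq> y}"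

definition distinct_reps :: "'a::times set \<Rightarrow> 'a \<Rightarrow> ('a \<times> 'a) set" where
  "distinct_reps A c = {(x, y). x \<in> A \<and> y \<in> A \<and> x \<noteq> y \<and> x * y = c}"

end

theory Submission
  imports Defs "HOL-Computational_Algebra.Polynomial"
begin

text \<open>
  The argument is a polynomial-method argument on a grid. Let \<open>C\<close> be the restricted product set
  of \<open>A\<close>. Substituting \<open>z = inverse y\<close> for the second factor makes both conditions on a pair
  \<open>(x, y)\<close> cheap in terms of degree: \<open>x * y = e\<close> becomes the vanishing of the \<^emph>\<open>linear\<close> form
  \<open>x - e * z\<close>, and \<open>x = y\<close> becomes the vanishing of the quadratic \<open>x * z - 1\<close>. Hence
  \<open>f x z = (x - b) * (x * z - 1) * (\<Prod>e\<in>C - {c}. x - e * z)\<close> has total degree at most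
  \<open>card C + 2\<close>. On the grid \<open>A \<times> inverse ` A\<close>, the last two factors kill every pair except the two
  representations \<open>(a, b)\<close> and \<open>(b, a)\<close> of \<open>c\<close>; in particular, they kill the pairs \<open>(d, d)\<close> with
  \<open>d * d = c\<close>. The factor \<open>x - b\<close> then kills \<open>(b, a)\<close>, so \<open>f\<close> is nonzero at exactly one grid point.

  Such an \<open>f\<close> must have large degree (lemma \<open>degree_ge_if_unique_nonzero\<close>): the weighted sum of
  its values over an \<open>m \<times> n\<close> grid, with Lagrange weights, extracts the coefficient of
  \<open>x ^ (m - 1) * z ^ (n - 1)\<close> from any polynomial of total degree at most \<open>m + n - 2\<close>. So it
  vanishes on all polynomials of total degree below \<open>m + n - 2\<close> (lemma
  \<open>lagrange_sum_bivariate_eq_0\<close>), whereas a single nonzero term cannot cancel. Here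
  \<open>m = n = card A\<close>, so \<open>card C + 2 \<ge> 2 * card A - 2\<close>.
\<close>

definition lagrange_weight :: "'a::field set \<Rightarrow> 'a \<Rightarrow> 'a" where
  "lagrange_weight A x = inverse (\<Prod>y\<in>A - {x}. x - y)"

lemma lagrange_weight_nonzero:
  assumes "finite A"
  shows "lagrange_weight A x \<noteq> 0"
  using assms by (auto simp: lagrange_weight_def)

text \<open>
  Interpolating the monomial \<open>X ^ i\<close> at the points of \<open>A\<close> reproduces it, because its degree is
  below \<open>card A\<close>; since the Lagrange basis
  polynomials are monic up to their weights, the sum is the coefficient of degree \<open>card A - 1\<close> of
  the interpolant.
\<close>
lemma lagrange_sum_power_eq_0:
  fixes A :: "'a::field set"
  assumes fin: "finite A" and i: "i + 1 < card A"
  shows "(\<Sum>x\<in>A. lagrange_weight A x * x ^ i) = 0"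
proof -
  define basis :: "'a \<Rightarrow> 'a poly" where "basis = (\<lambda>x. \<Prod>y\<in>A - {x}. [:- y, 1:])"
  define p where "p = (\<Sum>x\<in>A. smult (lagrange_weight A x * x ^ i) (basis x))"
  have deg_basis: "degree (basis x) = card A - 1" if "x \<in> A" for x
    using that fin by (simp add: basis_def degree_prod_eq_sum_degree card_Diff_singleton)
  have lead_basis: "coeff (basis x) (card A - 1) = 1" if "x \<in> A" for x
  proof -
    have "lead_coeff (basis x) = 1"
      by (simp add: basis_def lead_coeff_prod)
    then show ?thesis
      using deg_basis[OF that] by simp
  qed
  have "degree p \<le> card A - 1"
    unfolding p_def
    by (intro degree_sum_le fin) (metis deg_basis degree_smult_le)
  then have deg_p: "degree p < card A"
    using i by linarith
  have poly_p: "poly p x = x ^ i" if "x \<in> A" for x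
  proof -
    have "poly (basis y) x = 0" if "y \<in> A" "y \<noteq> x" for y
      using fin \<open>x \<in> A\<close> that by (auto simp: basis_def poly_prod)
    then have "poly p x = (\<Sum>y\<in>A. if y = x then lagrange_weight A x * x ^ i * poly (basis x) x else 0)"
      unfolding p_def poly_sum by (intro sum.cong) auto
    also have "\<dots> = lagrange_weight A x * poly (basis x) x * x ^ i"
      using fin that by simp
    also have "lagrange_weight A x * poly (basis x) x = 1"
      using fin by (simp add: lagrange_weight_def basis_def poly_prod)
    finally show ?thesis by simp
  qed
  have "p = monom 1 i"
    by (rule poly_eqI_degree[of A])
      (use i poly_p deg_p in \<open>auto simp: poly_monom degree_monom_eq\<close>)
  then have "coeff p (card A - 1) = 0"
    using i by simp
  moreover have "coeff p (card A - 1) = (\<Sum>x\<in>A. lagrange_weight A x * x ^ i)"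
    unfolding p_def coeff_sum using lead_basis by (intro sum.cong) simp_all
  ultimately show ?thesis by simp
qed

text \<open>
  The functions given by bivariate polynomials of total degree at most \<open>d\<close>. Generating them from
  monomials by addition lets linear functionals be evaluated by rule induction.
\<close>
inductive bivariate :: "nat \<Rightarrow> ('a::field \<Rightarrow> 'a \<Rightarrow> 'a) \<Rightarrow> bool" for d where
  monomial: "i + j \<le> d \<Longrightarrow> bivariate d (\<lambda>x z. r * x ^ i * z ^ j)"
| add: "bivariate d f \<Longrightarrow> bivariate d g \<Longrightarrow> bivariate d (\<lambda>x z. f x z + g x z)"

lemma bivariate_mult_monomial:
  assumes "bivariate d f"
  shows "bivariate (d + k + l) (\<lambda>x z. r * x ^ k * z ^ l * f x z)"
  using assms
proof induction
  case (monomial i j s)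
  have "bivariate (d + k + l) (\<lambda>x z. (r * s) * x ^ (k + i) * z ^ (l + j))"
    using monomial by (intro bivariate.monomial) auto
  then show ?case
    by (simp add: power_add mult_ac)
next
  case (add f g)
  then show ?case
    by (simp add: distrib_left bivariate.add)
qed

lemma bivariate_mono:
  assumes "bivariate d f" "d \<le> d'"
  shows "bivariate d' f"
  using assms by induction (auto intro: bivariate.intros)

lemma bivariate_mult_linear:
  assumes "bivariate d f"
  shows "bivariate (Suc d) (\<lambda>x z. (x - s * z) * f x z)"
proof -
  have "bivariate (Suc d) (\<lambda>x z. 1 * x ^ 1 * z ^ 0 * f x z)"
    using bivariate_mult_monomial[OF assms, of 1 0 1] by simp
  moreover have "bivariate (Suc d) (\<lambda>x z. - s * x ^ 0 * z ^ 1 * f x z)"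
    using bivariate_mult_monomial[OF assms, of 0 1 "- s"] by simp
  ultimately have "bivariate (Suc d) (\<lambda>x z. 1 * x ^ 1 * z ^ 0 * f x z + - s * x ^ 0 * z ^ 1 * f x z)"
    by (rule bivariate.add)
  then show ?thesis by (simp add: algebra_simps)
qed

lemma bivariate_mult_minus_const:
  assumes "bivariate d f"
  shows "bivariate (Suc d) (\<lambda>x z. (x - s) * f x z)"
proof -
  have "bivariate (Suc d) (\<lambda>x z. 1 * x ^ 1 * z ^ 0 * f x z)"
    using bivariate_mult_monomial[OF assms, of 1 0 1] by simp
  moreover have "bivariate (Suc d) (\<lambda>x z. - s * x ^ 0 * z ^ 0 * f x z)"
    using bivariate_mult_monomial[OF assms, of 0 0 "- s"] by (auto intro: bivariate_mono)
  ultimately have "bivariate (Suc d) (\<lambda>x z. 1 * x ^ 1 * z ^ 0 * f x z + - s * x ^ 0 * z ^ 0 * f x z)"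
    by (rule bivariate.add)
  then show ?thesis by (simp add: algebra_simps)
qed

lemma bivariate_prod_linear:
  assumes "finite E"
  shows "bivariate (card E) (\<lambda>x z. \<Prod>e\<in>E. x - e * z)"
  using assms
proof induction
  case empty
  show ?case
    using bivariate.monomial[of 0 0 0 1] by simp
next
  case (insert e E)
  then show ?case
    using bivariate_mult_linear[of "card E" _ e] by simp
qed

text \<open>
  On a monomial the sum factors over the two variables, and a total degree below
  \<open>(card A - 1) + (card B - 1)\<close> forces the exponent of one of them to be too small.
\<close>
lemma lagrange_sum_bivariate_eq_0:
  assumes "bivariate d f" and fin: "finite A" "finite B" and d: "d + 2 < card A + card B"
  shows "(\<Sum>x\<in>A. \<Sum>z\<in>B. lagrange_weight A x * lagrange_weight B z * f x z) = 0"
  using assms(1)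
proof induction
  case (monomial i j r)
  have "(\<Sum>x\<in>A. \<Sum>z\<in>B. lagrange_weight A x * lagrange_weight B z * (r * x ^ i * z ^ j))
      = r * ((\<Sum>x\<in>A. lagrange_weight A x * x ^ i) * (\<Sum>z\<in>B. lagrange_weight B z * z ^ j))"
    unfolding sum_product by (simp add: sum_distrib_left mult_ac)
  moreover have "i + 1 < card A \<or> j + 1 < card B"
    using monomial d by linarith
  ultimately show ?case
    using lagrange_sum_power_eq_0[OF fin(1)] lagrange_sum_power_eq_0[OF fin(2)] by auto
next
  case (add f g)
  then show ?case
    by (simp add: distrib_left sum.distrib)
qed

lemma degree_ge_if_unique_nonzero:
  assumes f: "bivariate d f" and fin: "finite A" "finite B"
    and uv: "u \<in> A" "v \<in> B" "f u v \<noteq> 0"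
    and unique: "\<And>x z. x \<in> A \<Longrightarrow> z \<in> B \<Longrightarrow> f x z \<noteq> 0 \<Longrightarrow> x = u \<and> z = v"
  shows "card A + card B \<le> d + 2"
proof (rule ccontr)
  assume "\<not> ?thesis"
  then have "(\<Sum>x\<in>A. \<Sum>z\<in>B. lagrange_weight A x * lagrange_weight B z * f x z) = 0"
    by (intro lagrange_sum_bivariate_eq_0[OF f fin]) simp
  moreover have "(\<Sum>x\<in>A. \<Sum>z\<in>B. lagrange_weight A x * lagrange_weight B z * f x z)
      = (\<Sum>x\<in>A. \<Sum>z\<in>B. if x = u then if z = v
          then lagrange_weight A u * lagrange_weight B v * f u v else 0 else 0)"
    proof (intro sum.cong refl)
    fix x z assume "x \<in> A" "z \<in> B"
    with unique[of x z] show "lagrange_weight A x * lagrange_weight B z * f x z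
      = (if x = u then if z = v then lagrange_weight A u * lagrange_weight B v * f u v else 0 else 0)"
      by (cases "f x z = 0") auto
  qed
  moreover have "\<dots> = (\<Sum>x\<in>A. if x = u then \<Sum>z\<in>B. if z = v
          then lagrange_weight A u * lagrange_weight B v * f u v else 0 else 0)"
    by (intro sum.cong) auto
  moreover have "\<dots> = lagrange_weight A u * lagrange_weight B v * f u v"
    using uv fin by simp
  ultimately show False
    using uv fin by (simp add: lagrange_weight_nonzero)
qed

lemma finite_restricted_product:
  assumes "finite A"
  shows "finite (restricted_product A)"
  by (rule finite_subset[of _ "(\<lambda>(x, y). x * y) ` (A \<times> A)"])
    (use assms in \<open>auto simp: restricted_product_def\<close>)

theorem corollary6:
  fixes A :: "'a::field set" and a b c :: 'a
  assumes "finite A"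
    and "A \<subseteq> UNIV - {0}"
    and "c \<in> restricted_product A"
    and "a \<in> A" and "b \<in> A" and "a \<noteq> b"
    and "distinct_reps A c = {(a, b), (b, a)}"
  shows "int (card (restricted_product A)) \<ge> 2 * int (card A) - 4"
proof -
  define E where "E = restricted_product A - {c}"
  define B where "B = inverse ` A"
  define g :: "'a \<Rightarrow> 'a \<Rightarrow> 'a" where "g = (\<lambda>x z. \<Prod>e\<in>E. x - e * z)"
  define f where "f = (\<lambda>x z. (x - b) * ((x * z - 1) * g x z))"
  have nz: "x \<noteq> 0" if "x \<in> A" for x
    using assms(2) that by auto
  have fin_C: "finite (restricted_product A)"
    using assms(1) by (rule finite_restricted_product)
  then have fin_E: "finite E" by (simp add: E_def)
  have card_C: "card (restricted_product A) = Suc (card E)"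
    unfolding E_def using card.remove[OF fin_C assms(3)] .
  have fin_B: "finite B" and card_B: "card B = card A"
    using assms(1) by (auto simp: B_def intro!: card_image inj_onI)

  have g: "bivariate (card E) g"
    unfolding g_def by (rule bivariate_prod_linear[OF fin_E])
  have "bivariate (card E + 2) (\<lambda>x z. 1 * x ^ 1 * z ^ 1 * g x z + - 1 * x ^ 0 * z ^ 0 * g x z)"
    using bivariate_mult_monomial[OF g, of 1 1 1] bivariate_mult_monomial[OF g, of 0 0 "- 1"]
    by (intro bivariate.add) (auto intro: bivariate_mono)
  then have "bivariate (card E + 2) (\<lambda>x z. (x * z - 1) * g x z)"
    by (simp add: algebra_simps)
  then have f: "bivariate (card E + 3) f"
    using bivariate_mult_minus_const[of "card E + 2" _ b] by (simp add: f_def numeral_3_eq_3)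

  have g_nz_iff: "g x (inverse y) \<noteq> 0 \<longleftrightarrow> x * y \<notin> E" if "y \<in> A" for x y
  proof -
    have "x - e * inverse y = 0 \<longleftrightarrow> x * y = e" for e
      using nz[OF that] by (simp add: divide_inverse [symmetric] eq_divide_eq)
    then show ?thesis
      using fin_E by (auto simp: g_def)
  qed
  have "(a, b) \<in> distinct_reps A c"
    using assms(7) by simp
  then have "a * b \<notin> E"
    by (simp add: E_def distinct_reps_def)
  then have "g a (inverse b) \<noteq> 0"
    using g_nz_iff[OF assms(5)] by simp
  moreover have "a * inverse b \<noteq> 1"
    using assms(6) nz[OF assms(5)] by (simp add: divide_inverse [symmetric])
  ultimately have f_nz: "f a (inverse b) \<noteq> 0"
    using assms(6) by (simp add: f_def)
  have unique: "x = a \<and> z = inverse b" if "x \<in> A" "z \<in> B" "f x z \<noteq> 0" for x z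
  proof -
    from that(2) obtain y where y: "y \<in> A" "z = inverse y"
      by (auto simp: B_def)
    have "x \<noteq> b" "x \<noteq> y" "x * y \<notin> E"
      using that y nz g_nz_iff[OF y(1)] by (auto simp: f_def)
    then have "(x, y) \<in> distinct_reps A c"
      using that y by (auto simp: E_def restricted_product_def distinct_reps_def)
    then show ?thesis
      using \<open>x \<noteq> b\<close> y assms(7) by auto
  qed
  have "inverse b \<in> B"
    using assms(5) by (simp add: B_def)
  from degree_ge_if_unique_nonzero[OF f assms(1) fin_B assms(4) this f_nz unique]
  have "card A + card B \<le> card E + 3 + 2" .
  then show ?thesis
    using card_B card_C by simp
qed

end
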